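(* The calculus PC$\pm$ is complete with respect to $\vDash_{PC\pm}$: every formula of $\mathcal{L}_{PC\pm}$ true at every world of every conditional neighbourhood model under $\vDash_{PC\pm}$ is derivable in PC$\pm$.
   Context: Fix a set $P$ of proposition letters and a finite set $Ag$ of agents. The language $\mathcal{L}_{PC\pm}$ is $\phi::=\top\mid p\mid\neg\phi\mid(\phi\wedge\phi)\mid B_a(\phi,\phi)\mid[\pm\phi]\phi$ ($p\in P$, $a\in Ag$); $\bot,\vee,\to,\leftrightarrow$ as usual, $K_a\phi:=\neg B_a(\neg\phi,\top)$, $\check K_a\phi:=\neg K_a\neg\phi$. A conditional neighbourhood model is $\mathfrak{M}=(W,N,V)$: $W$ non-empty, $V:P\to\mathcal{P}(W)$, and $N$ assigns to each $a\in Ag$, $w\in W$, $X\subseteq W$ a set $N_a^w(X)\subseteq\mathcal{P}(W)$ such that, writing $[w]_a=\{v\mid\forall X\subseteq W,\ N_a^w(X)=N_a^v(X)\}$ (the class of $w$ under the induced equivalence $\sim_a$): (c) each $Y\in N_a^w(X)$ has $Y\subseteq X\cap[w]_a$; (ec) if $X\cap[w]_a=Y\cap[w]_a$ then $N_a^w(X)=N_a^w(Y)$; (d) for $Y\in N_a^w(X)$, $(X\cap[w]_a)\setminus Y\notin N_a^w(X)$; (sc) for $Y,Z\subseteq X\cap[w]_a$, if $(X\cap[w]_a)\setminus Y\notin N_a^w(X)$ and $Y\subsetneq Z$ then $Z\in N_a^w(X)$. Semantics $\vDash_{PC\pm}$: $\top$ always true; $p$ iff $w\in V(p)$; Booleans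 as usual; $\mathfrak{M},w\vDash B_a(\phi,\psi)$ iff some $Y\in N_a^w(\llbracket\phi\rrbracket_{\mathfrak{M}})$ has $Y\subseteq\llbracket\psi\rrbracket_{\mathfrak{M}}$ (with $\llbracket\phi\rrbracket_{\mathfrak{M}}=\{v\mid\mathfrak{M},v\vDash\phi\}$); $\mathfrak{M},w\vDash[\pm\phi]\psi$ iff $\mathfrak{M}^{\pm\phi},w\vDash\psi$. The update $\mathfrak{M}^{\pm\phi}=(W,{}^{\pm\phi}N,V)$: let $w\sim_a^{\pm\phi}v$ iff $w\sim_a v$ and ($\mathfrak{M},w\vDash\phi$ iff $\mathfrak{M},v\vDash\phi$), with classes $[w]_a^{\pm\phi}$, and put ${}^{\pm\phi}N_a^w(X)=N_a^w(X\cap[w]_a^{\pm\phi})$. The calculus PC$\pm$ consists of the CN calculus over $\mathcal{L}_{PC\pm}$ — axioms (Taut) propositional tautologies; (Dist-K) $K_a(\phi\to\psi)\to K_a\phi\to K_a\psi$; (T) $K_a\phi\to\phi$; (5B) $B_a(\phi,\psi)\to K_aB_a(\phi,\psi)$; (4B) $\neg B_a(\phi,\psi)\to K_a\neg B_a(\phi,\psi)$; (D) $B_a(\phi,\psi)\to\neg B_a(\phi,\neg\psi)$; (EC) $K_a(\phi\leftrightarrow\psi)\to B_a(\phi,\chi)\to B_a(\psi,\chi)$; (M) $K_a(\phi\to\psi)\to B_a(\chi,\phi)\to B_a(\chi,\psi)$; (C) $B_a(\phi,\psi)\to B_a(\phi,\phi\wedge\psi)$; (SC) $\neg B_a(\chi,\neg\phi)\wedge\check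 K_a(\chi\wedge\neg\phi\wedge\psi)\to B_a(\chi,\phi\vee\psi)$; rules Modus Ponens and from $\phi$ infer $K_a\phi$ — plus the reduction axioms $[\pm\phi]p\leftrightarrow p$, $[\pm\phi]\neg\psi\leftrightarrow\neg[\pm\phi]\psi$, $[\pm\phi](\psi\wedge\chi)\leftrightarrow([\pm\phi]\psi\wedge[\pm\phi]\chi)$, and $[\pm\phi]B_a(\psi,\chi)\leftrightarrow(\phi\to B_a(\phi\wedge[\pm\phi]\psi,[\pm\phi]\chi))\wedge(\neg\phi\to B_a(\neg\phi\wedge[\pm\phi]\psi,[\pm\phi]\chi))$.
   Formalization: The calculus PC± is extended by the sound rule "from ψ↔χ infer [±φ]ψ↔[±φ]χ"; with only the listed axioms and rules the claim is false, since e.g. the valid formula [±φ]⊤ is not derivable. *)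

theory Defs
  imports Main
begin

section \<open>Language\<close>

text \<open>Proposition letters and agents are the elements of the types \<open>'p\<close> and \<open>'a\<close>.
  \<open>Bel a \<phi> \<psi>\<close> is the belief of \<open>\<psi>\<close> conditional on \<open>\<phi>\<close>, and \<open>Upd \<phi> \<psi>\<close> is the formula
  \<open>[\<plusminus>\<phi>]\<psi>\<close>.\<close>

datatype ('p, 'a) form =
    Top
  | Atom 'p
  | Neg "('p, 'a) form"
  | Con "('p, 'a) form" "('p, 'a) form"
  | Bel 'a "('p, 'a) form" "('p, 'a) form"
  | Upd "('p, 'a) form" "('p, 'a) form"

abbreviation Dis :: "('p, 'a) form \<Rightarrow> ('p, 'a) form \<Rightarrow> ('p, 'a) form" where
  "Dis \<phi> \<psi> \<equiv> Neg (Con (Neg \<phi>) (Neg \<psi>))"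

abbreviation Imp :: "('p, 'a) form \<Rightarrow> ('p, 'a) form \<Rightarrow> ('p, 'a) form" where
  "Imp \<phi> \<psi> \<equiv> Neg (Con \<phi> (Neg \<psi>))"

abbreviation Iff :: "('p, 'a) form \<Rightarrow> ('p, 'a) form \<Rightarrow> ('p, 'a) form" where
  "Iff \<phi> \<psi> \<equiv> Con (Imp \<phi> \<psi>) (Imp \<psi> \<phi>)"

abbreviation Know :: "'a \<Rightarrow> ('p, 'a) form \<Rightarrow> ('p, 'a) form" where
  "Know a \<phi> \<equiv> Neg (Bel a (Neg \<phi>) Top)"

abbreviation Poss :: "'a \<Rightarrow> ('p, 'a) form \<Rightarrow> ('p, 'a) form" where
  "Poss a \<phi> \<equiv> Neg (Know a (Neg \<phi>))"


section \<open>Conditional neighbourhood models\<close>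

text \<open>The value of \<open>nbh\<close> is relevant only at worlds of the model and at subsets of its set of
  worlds; elsewhere it is unconstrained.\<close>

record ('w, 'p, 'a) cn_struct =
  worlds :: "'w set"
  nbh :: "'a \<Rightarrow> 'w \<Rightarrow> 'w set \<Rightarrow> 'w set set"
  val :: "'p \<Rightarrow> 'w set"

definition cell :: "('w, 'p, 'a) cn_struct \<Rightarrow> 'a \<Rightarrow> 'w \<Rightarrow> 'w set" where
  "cell M a w = {v \<in> worlds M. \<forall>X \<subseteq> worlds M. nbh M a w X = nbh M a v X}"

definition cn_model :: "('w, 'p, 'a) cn_struct \<Rightarrow> bool" where
  "cn_model M \<longleftrightarrow>
     worlds M \<noteq> {} \<and>
     (\<forall>p. val M p \<subseteq> worlds M) \<and>
     (\<forall>a. \<forall>w \<in> worlds M. \<forall>X \<subseteq> worlds M.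
        (\<forall>Y \<in> nbh M a w X. Y \<subseteq> X \<inter> cell M a w) \<and>
        (\<forall>Y \<subseteq> worlds M. X \<inter> cell M a w = Y \<inter> cell M a w \<longrightarrow> nbh M a w X = nbh M a w Y) \<and>
        (\<forall>Y \<in> nbh M a w X. (X \<inter> cell M a w) - Y \<notin> nbh M a w X) \<and>
        (\<forall>Y Z. Y \<subseteq> X \<inter> cell M a w \<longrightarrow> Z \<subseteq> X \<inter> cell M a w \<longrightarrow>
           (X \<inter> cell M a w) - Y \<notin> nbh M a w X \<longrightarrow> Y \<subset> Z \<longrightarrow> Z \<in> nbh M a w X))"


section \<open>Semantics\<close>

text \<open>The update depends on the updating formula only through its truth set \<open>A\<close>.\<close>

definition upd_cell :: "('w, 'p, 'a) cn_struct \<Rightarrow> 'w set \<Rightarrow> 'a \<Rightarrow> 'w \<Rightarrow> 'w set" where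
  "upd_cell M A a w = {v \<in> cell M a w. w \<in> A \<longleftrightarrow> v \<in> A}"

definition update :: "('w, 'p, 'a) cn_struct \<Rightarrow> 'w set \<Rightarrow> ('w, 'p, 'a) cn_struct" where
  "update M A = M\<lparr>nbh := \<lambda>a w X. nbh M a w (X \<inter> upd_cell M A a w)\<rparr>"

fun sat :: "('w, 'p, 'a) cn_struct \<Rightarrow> 'w \<Rightarrow> ('p, 'a) form \<Rightarrow> bool" (\<open>_, _ \<Turnstile> _\<close> [51, 51, 51] 50) where
  "M, w \<Turnstile> Top \<longleftrightarrow> True"
| "M, w \<Turnstile> Atom p \<longleftrightarrow> w \<in> val M p"
| "M, w \<Turnstile> Neg \<phi> \<longleftrightarrow> \<not> M, w \<Turnstile> \<phi>"
| "M, w \<Turnstile> Con \<phi> \<psi> \<longleftrightarrow> M, w \<Turnstile> \<phi> \<and> M, w \<Turnstile> \<psi>"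
| "M, w \<Turnstile> Bel a \<phi> \<psi> \<longleftrightarrow>
     (\<exists>Y \<in> nbh M a w {v \<in> worlds M. M, v \<Turnstile> \<phi>}. Y \<subseteq> {v \<in> worlds M. M, v \<Turnstile> \<psi>})"
| "M, w \<Turnstile> Upd \<phi> \<psi> \<longleftrightarrow> update M {v \<in> worlds M. M, v \<Turnstile> \<phi>}, w \<Turnstile> \<psi>"


section \<open>Calculus\<close>

text \<open>A propositional tautology is true under every Boolean valuation \<open>g\<close> of the formulas
  whose main operator is not Boolean.\<close>

primrec bool_val :: "(('p, 'a) form \<Rightarrow> bool) \<Rightarrow> ('p, 'a) form \<Rightarrow> bool" where
  "bool_val g Top \<longleftrightarrow> True"
| "bool_val g (Atom p) \<longleftrightarrow> g (Atom p)"
| "bool_val g (Neg \<phi>) \<longleftrightarrow> \<not> bool_val g \<phi>"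
| "bool_val g (Con \<phi> \<psi>) \<longleftrightarrow> bool_val g \<phi> \<and> bool_val g \<psi>"
| "bool_val g (Bel a \<phi> \<psi>) \<longleftrightarrow> g (Bel a \<phi> \<psi>)"
| "bool_val g (Upd \<phi> \<psi>) \<longleftrightarrow> g (Upd \<phi> \<psi>)"

definition tautology :: "('p, 'a) form \<Rightarrow> bool" where
  "tautology \<phi> \<longleftrightarrow> (\<forall>g. bool_val g \<phi>)"

text \<open>The rule \<open>RE_Upd\<close> (replacement of provable equivalents below an update, a sound rule) makes
  explicit a convention that goes with reduction axioms. The four reduction axioms say nothing about
  \<open>[\<plusminus>\<phi>]\<psi>\<close> when \<open>\<psi>\<close> is \<open>\<top>\<close> or is itself of the form \<open>[\<plusminus>\<chi>]\<theta>\<close>; without the rule the valid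
  formulas \<open>[\<plusminus>\<phi>]\<top>\<close> and \<open>[\<plusminus>\<phi>][\<plusminus>\<chi>]\<top>\<close> are not derivable. In the presence of the
  other axioms the rule is interderivable with necessitation for \<open>[\<plusminus>\<phi>]\<close>.\<close>

inductive derivable :: "('p, 'a) form \<Rightarrow> bool" (\<open>\<turnstile> _\<close> [51] 50) where
  Taut: "tautology \<phi> \<Longrightarrow> \<turnstile> \<phi>"
| Dist_K: "\<turnstile> Imp (Know a (Imp \<phi> \<psi>)) (Imp (Know a \<phi>) (Know a \<psi>))"
| T: "\<turnstile> Imp (Know a \<phi>) \<phi>"
| Five_B: "\<turnstile> Imp (Bel a \<phi> \<psi>) (Know a (Bel a \<phi> \<psi>))"
| Four_B: "\<turnstile> Imp (Neg (Bel a \<phi> \<psi>)) (Know a (Neg (Bel a \<phi> \<psi>)))"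
| D: "\<turnstile> Imp (Bel a \<phi> \<psi>) (Neg (Bel a \<phi> (Neg \<psi>)))"
| EC: "\<turnstile> Imp (Know a (Iff \<phi> \<psi>)) (Imp (Bel a \<phi> \<chi>) (Bel a \<psi> \<chi>))"
| M: "\<turnstile> Imp (Know a (Imp \<phi> \<psi>)) (Imp (Bel a \<chi> \<phi>) (Bel a \<chi> \<psi>))"
| C: "\<turnstile> Imp (Bel a \<phi> \<psi>) (Bel a \<phi> (Con \<phi> \<psi>))"
| SC: "\<turnstile> Imp (Con (Neg (Bel a \<chi> (Neg \<phi>))) (Poss a (Con (Con \<chi> (Neg \<phi>)) \<psi>)))
           (Bel a \<chi> (Dis \<phi> \<psi>))"
| Upd_Atom: "\<turnstile> Iff (Upd \<phi> (Atom p)) (Atom p)"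
| Upd_Neg: "\<turnstile> Iff (Upd \<phi> (Neg \<psi>)) (Neg (Upd \<phi> \<psi>))"
| Upd_Con: "\<turnstile> Iff (Upd \<phi> (Con \<psi> \<chi>)) (Con (Upd \<phi> \<psi>) (Upd \<phi> \<chi>))"
| Upd_Bel: "\<turnstile> Iff (Upd \<phi> (Bel a \<psi> \<chi>))
           (Con (Imp \<phi> (Bel a (Con \<phi> (Upd \<phi> \<psi>)) (Upd \<phi> \<chi>)))
                (Imp (Neg \<phi>) (Bel a (Con (Neg \<phi>) (Upd \<phi> \<psi>)) (Upd \<phi> \<chi>))))"
| MP: "\<turnstile> Imp \<phi> \<psi> \<Longrightarrow> \<turnstile> \<phi> \<Longrightarrow> \<turnstile> \<psi>"
| Nec_K: "\<turnstile> \<phi> \<Longrightarrow> \<turnstile> Know a \<phi>"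
| RE_Upd: "\<turnstile> Iff \<psi> \<chi> \<Longrightarrow> \<turnstile> Iff (Upd \<phi> \<psi>) (Upd \<phi> \<chi>)"


section \<open>Validity\<close>

text \<open>HOL cannot quantify over types inside a formula, so the worlds are drawn from one fixed type,
  chosen large enough to contain every model built from maximal consistent sets of formulas.
  A formula true in all models whatsoever is in particular valid in this sense, so completeness for
  \<open>valid\<close> covers the unrestricted notion.\<close>

definition valid :: "('p, 'a) form \<Rightarrow> bool" where
  "valid \<phi> \<longleftrightarrow>
     (\<forall>M :: (('p, 'a) form set, 'p, 'a) cn_struct. cn_model M \<longrightarrow> (\<forall>w \<in> worlds M. M, w \<Turnstile> \<phi>))"

end

theory Submission
  imports Defs
begin

text \<open>The reduction axioms turn every formula into a provably and semantically equivalent formula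
  without updates, so it suffices to build a canonical model that is correct for update-free
  formulas. Its worlds are all maximal consistent sets, and the cell of \<open>w\<close> for \<open>a\<close> consists of the
  sets containing the same formulas \<open>Bel a \<phi> \<psi>\<close> as \<open>w\<close>. Membership of these formulas prescribes
  which definable subsets of a definable set \<open>S\<close> are neighbourhoods. The prescription extends to all
  subsets of \<open>S\<close>: take the supersets of prescribed sets and the strict supersets of definable ties
  (sets such that neither they nor their complements are believed), and decide the remaining
  complementary pairs by whether they contain a fixed point of \<open>S\<close>.\<close>

section \<open>Maximal consistent sets\<close>

text \<open>Only modus ponens acts on hypotheses; \<open>Nec_K\<close> and \<open>RE_Upd\<close>
  enter through \<open>ded_thm\<close>, on theorems alone. This keeps the deduction theorem
  true.\<close>

inductive ded :: "('p, 'a) form set \<Rightarrow> ('p, 'a) form \<Rightarrow> bool" for \<Gamma> where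
  ded_hyp: "\<phi> \<in> \<Gamma> \<Longrightarrow> ded \<Gamma> \<phi>"
| ded_thm: "\<turnstile> \<phi> \<Longrightarrow> ded \<Gamma> \<phi>"
| ded_mp: "ded \<Gamma> (Imp \<phi> \<psi>) \<Longrightarrow> ded \<Gamma> \<phi> \<Longrightarrow> ded \<Gamma> \<psi>"

lemma ded_taut: "tautology \<phi> \<Longrightarrow> ded \<Gamma> \<phi>"
  by (intro ded_thm Taut)

lemma ded_taut_mp: "tautology (Imp \<phi> \<psi>) \<Longrightarrow> ded \<Gamma> \<phi> \<Longrightarrow> ded \<Gamma> \<psi>"
  by (rule ded_mp[OF ded_taut])

lemma ded_taut_mp2: "tautology (Imp \<phi> (Imp \<psi> \<chi>)) \<Longrightarrow> ded \<Gamma> \<phi> \<Longrightarrow> ded \<Gamma> \<psi> \<Longrightarrow> ded \<Gamma> \<chi>"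
  by (rule ded_mp[OF ded_taut_mp])

lemma ded_empty: "ded {} \<phi> \<Longrightarrow> \<turnstile> \<phi>"
  by (induction rule: ded.induct) (auto intro: MP)

lemma ded_mono: "ded \<Gamma> \<phi> \<Longrightarrow> \<Gamma> \<subseteq> \<Delta> \<Longrightarrow> ded \<Delta> \<phi>"
  by (induction rule: ded.induct) (auto intro: ded.intros)

lemma deduction: "ded (insert \<chi> \<Gamma>) \<phi> \<Longrightarrow> ded \<Gamma> (Imp \<chi> \<phi>)"
proof (induction rule: ded.induct)
  case (ded_hyp \<phi>)
  show ?case
  proof (cases "\<phi> = \<chi>")
    case True
    then show ?thesis by (simp add: ded_taut tautology_def)
  next
    case False
    then have "ded \<Gamma> \<phi>" using ded_hyp by (auto intro: ded.ded_hyp)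
    then show ?thesis by (rule ded_taut_mp[rotated]) (simp add: tautology_def)
  qed
next
  case (ded_thm \<phi>)
  then have "ded \<Gamma> \<phi>" by (rule ded.ded_thm)
  then show ?case by (rule ded_taut_mp[rotated]) (simp add: tautology_def)
next
  case (ded_mp \<phi> \<psi>)
  show ?case by (rule ded_taut_mp2[OF _ ded_mp.IH]) (simp add: tautology_def)
qed

text \<open>Two premises of \<open>ded_mp\<close> come from two members of the chain, and the larger
  of these yields both.\<close>

lemma ded_Union_chain:
  assumes "ded (\<Union>\<C>) \<phi>" "subset.chain A \<C>" "\<C> \<noteq> {}"
  shows "\<exists>\<Delta>\<in>\<C>. ded \<Delta> \<phi>"
  using assms(1)
proof (induction rule: ded.induct)
  case (ded_hyp \<phi>)
  then show ?case by (auto intro: ded.ded_hyp)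
next
  case (ded_thm \<phi>)
  then show ?case using assms(3) by (auto intro: ded.ded_thm)
next
  case (ded_mp \<phi> \<psi>)
  then obtain \<Delta> \<Delta>' where *: "\<Delta> \<in> \<C>" "\<Delta>' \<in> \<C>" "ded \<Delta> (Imp \<phi> \<psi>)" "ded \<Delta>' \<phi>" by blast
  then have "\<Delta> \<subseteq> \<Delta>' \<or> \<Delta>' \<subseteq> \<Delta>" using assms(2) by (auto simp: subset_chain_def)
  then show ?case using * by (meson ded.ded_mp ded_mono)
qed

definition mcs :: "('p, 'a) form set \<Rightarrow> bool" where
  "mcs w \<longleftrightarrow> (\<forall>\<phi>. ded w \<phi> \<longrightarrow> \<phi> \<in> w) \<and> (\<forall>\<phi>. Neg \<phi> \<in> w \<longleftrightarrow> \<phi> \<notin> w)"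

text \<open>Zorn's lemma gives a maximal extension of \<open>\<Gamma>\<close> among the sets that do
  not deduce \<open>\<phi>\<close>.\<close>

lemma lindenbaum:
  assumes "\<not> ded \<Gamma> \<phi>"
  obtains w where "mcs w" "\<Gamma> \<subseteq> w" "\<phi> \<notin> w"
proof -
  let ?A = "{\<Delta>. \<Gamma> \<subseteq> \<Delta> \<and> \<not> ded \<Delta> \<phi>}"
  have "\<exists>w\<in>?A. \<forall>\<Delta>\<in>?A. w \<subseteq> \<Delta> \<longrightarrow> \<Delta> = w"
  proof (rule subset_Zorn_nonempty)
    show "?A \<noteq> {}" using assms by blast
    fix \<C> assume \<C>: "\<C> \<noteq> {}" "subset.chain ?A \<C>"
    then have "\<C> \<subseteq> ?A" by (simp add: subset_chain_def)
    moreover from this have "\<not> ded (\<Union>\<C>) \<phi>" using ded_Union_chain[OF _ \<C>(2,1)] by blast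
    ultimately show "\<Union>\<C> \<in> ?A" using \<C>(1) by blast
  qed
  then obtain w where w: "\<Gamma> \<subseteq> w" "\<not> ded w \<phi>"
    and max: "\<And>\<Delta>. \<Gamma> \<subseteq> \<Delta> \<Longrightarrow> \<not> ded \<Delta> \<phi> \<Longrightarrow> w \<subseteq> \<Delta> \<Longrightarrow> \<Delta> = w" by auto
  \<comment> \<open>Maximality as used below: adding any formula outside \<open>w\<close> makes
    \<open>\<phi>\<close> deducible.\<close>
  have new: "ded w (Imp \<psi> \<phi>)" if "\<psi> \<notin> w" for \<psi>
  proof (rule deduction, rule ccontr)
    assume "\<not> ded (insert \<psi> w) \<phi>"
    then have "insert \<psi> w = w" using w(1) by (intro max) auto
    then show False using that by blast
  qed
  have "\<psi> \<in> w" if "ded w \<psi>" for \<psi>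
    using new w(2) that by (blast intro: ded_mp)
  moreover have "Neg \<psi> \<in> w \<longleftrightarrow> \<psi> \<notin> w" for \<psi>
  proof
    assume "Neg \<psi> \<in> w"
    then show "\<psi> \<notin> w"
      using w(2) ded_taut_mp2[of "Neg \<psi>" \<psi> \<phi> w] by (auto simp: tautology_def intro: ded_hyp)
  next
    assume "\<psi> \<notin> w"
    \<comment> \<open>Were both \<open>\<psi>\<close> and its negation to imply
      \<open>\<phi>\<close> over \<open>w\<close>, then \<open>w\<close> would deduce
      \<open>\<phi>\<close> by cases.\<close>
    then have "\<not> ded w (Imp (Neg \<psi>) \<phi>)"
      using w(2) new ded_taut_mp2[of "Imp \<psi> \<phi>" "Imp (Neg \<psi>) \<phi>" \<phi> w] by (auto simp: tautology_def)
    then show "Neg \<psi> \<in> w" using new by blast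
  qed
  ultimately have "mcs w" unfolding mcs_def by blast
  then show thesis using that w ded_hyp by blast
qed

lemma mcs_thm: "mcs w \<Longrightarrow> \<turnstile> \<phi> \<Longrightarrow> \<phi> \<in> w"
  by (simp add: mcs_def ded_thm)

lemma mcs_Neg [simp]: "mcs w \<Longrightarrow> Neg \<phi> \<in> w \<longleftrightarrow> \<phi> \<notin> w"
  by (simp add: mcs_def)

lemma mcs_Top [simp]: "mcs w \<Longrightarrow> Top \<in> w"
  by (simp add: mcs_thm Taut tautology_def)

lemma mcs_Con [simp]:
  assumes "mcs w"
  shows "Con \<phi> \<psi> \<in> w \<longleftrightarrow> \<phi> \<in> w \<and> \<psi> \<in> w"
proof -
  have closed: "\<chi> \<in> w" if "ded w \<chi>" for \<chi> using assms that by (simp add: mcs_def)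
  show ?thesis
  proof (intro iffI conjI)
    assume "Con \<phi> \<psi> \<in> w"
    then have "ded w (Con \<phi> \<psi>)" by (rule ded_hyp)
    then show "\<phi> \<in> w" "\<psi> \<in> w"
      by (auto intro!: closed elim!: ded_taut_mp[rotated] simp: tautology_def)
  next
    assume "\<phi> \<in> w \<and> \<psi> \<in> w"
    then have "ded w \<phi>" "ded w \<psi>" by (auto intro: ded_hyp)
    then have "ded w (Con \<phi> \<psi>)"
      by (rule ded_taut_mp2[rotated]) (simp add: tautology_def)
    then show "Con \<phi> \<psi> \<in> w" by (rule closed)
  qed
qed

text \<open>Provability is membership in all maximal consistent sets; through this equivalence
  propositional reasoning in the calculus becomes reasoning in HOL.\<close>

lemma derivable_iff_mcs: "\<turnstile> \<phi> \<longleftrightarrow> (\<forall>w. mcs w \<longrightarrow> \<phi> \<in> w)"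
  using mcs_thm ded_empty by (metis lindenbaum)

lemma derivable_Iff: "\<turnstile> Iff \<phi> \<psi> \<longleftrightarrow> (\<forall>w. mcs w \<longrightarrow> (\<phi> \<in> w \<longleftrightarrow> \<psi> \<in> w))"
  by (auto simp: derivable_iff_mcs)

lemma mcs_derivable_Iff: "mcs w \<Longrightarrow> \<turnstile> Iff \<phi> \<psi> \<Longrightarrow> \<phi> \<in> w \<longleftrightarrow> \<psi> \<in> w"
  by (simp add: derivable_Iff)


section \<open>Canonical cells\<close>

text \<open>Agreement on the belief formulas of \<open>a\<close> serves as the accessibility
  relation of \<open>Know a\<close>; this rests on \<open>Five_B\<close> and
  \<open>Four_B\<close>.\<close>

definition ccell :: "'a \<Rightarrow> ('p, 'a) form set \<Rightarrow> ('p, 'a) form set set" where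
  "ccell a w = {v. mcs v \<and> (\<forall>\<phi> \<psi>. Bel a \<phi> \<psi> \<in> v \<longleftrightarrow> Bel a \<phi> \<psi> \<in> w)}"

lemma ccell_mcs: "v \<in> ccell a w \<Longrightarrow> mcs v"
  by (simp add: ccell_def)

lemma ccell_refl: "mcs w \<Longrightarrow> w \<in> ccell a w"
  by (simp add: ccell_def)

lemma ccell_eq: "v \<in> ccell a w \<Longrightarrow> ccell a v = ccell a w"
  by (auto simp: ccell_def)

lemma ccell_Bel: "v \<in> ccell a w \<Longrightarrow> Bel a \<phi> \<psi> \<in> v \<longleftrightarrow> Bel a \<phi> \<psi> \<in> w"
  by (simp add: ccell_def)

lemma ded_Know:
  assumes w: "mcs w" and "ded {\<xi>. Know a \<xi> \<in> w} \<phi>"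
  shows "Know a \<phi> \<in> w"
  using assms(2)
proof (induction rule: ded.induct)
  case (ded_mp \<phi> \<psi>)
  then show ?case using mcs_thm[OF w Dist_K[of a \<phi> \<psi>]] w by simp
qed (simp_all add: mcs_thm[OF w Nec_K] del: mcs_Neg)

text \<open>From left to right, \<open>Know a \<phi>\<close> is a negated belief formula, hence
  shared by the cell, and \<open>T\<close> applies. Conversely, if \<open>\<phi>\<close> is not
  known, the known formulas do not deduce it, and a maximal consistent extension omitting
  \<open>\<phi>\<close> lies in the cell because \<open>Five_B\<close> and \<open>Four_B\<close>
  make belief and its absence known.\<close>

lemma mcs_Know:
  assumes w: "mcs w"
  shows "Know a \<phi> \<in> w \<longleftrightarrow> (\<forall>v \<in> ccell a w. \<phi> \<in> v)"
proof (intro iffI ballI)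
  fix v assume "Know a \<phi> \<in> w" and v: "v \<in> ccell a w"
  then have "Know a \<phi> \<in> v" using w ccell_mcs[OF v] by (simp add: ccell_Bel)
  then show "\<phi> \<in> v" using mcs_thm[OF ccell_mcs[OF v] T[of a \<phi>]] ccell_mcs[OF v] by simp
next
  assume all: "\<forall>v \<in> ccell a w. \<phi> \<in> v"
  show "Know a \<phi> \<in> w"
  proof (rule ccontr)
    assume "Know a \<phi> \<notin> w"
    then have "\<not> ded {\<xi>. Know a \<xi> \<in> w} \<phi>" using ded_Know[OF w] by blast
    then obtain v where v: "mcs v" "{\<xi>. Know a \<xi> \<in> w} \<subseteq> v" "\<phi> \<notin> v" by (rule lindenbaum)
    have "Bel a \<alpha> \<beta> \<in> v \<longleftrightarrow> Bel a \<alpha> \<beta> \<in> w" for \<alpha> \<beta>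
    proof (cases "Bel a \<alpha> \<beta> \<in> w")
      case True
      then have "Know a (Bel a \<alpha> \<beta>) \<in> w" using mcs_thm[OF w Five_B[of a \<alpha> \<beta>]] w by simp
      then show ?thesis using v True by blast
    next
      case False
      then have "Know a (Neg (Bel a \<alpha> \<beta>)) \<in> w" using mcs_thm[OF w Four_B[of a \<alpha> \<beta>]] w by simp
      then have "Neg (Bel a \<alpha> \<beta>) \<in> v" using v by blast
      then show ?thesis using v False by simp
    qed
    then have "v \<in> ccell a w" using v by (simp add: ccell_def)
    then show False using all v by blast
  qed
qed

section \<open>Truth sets within a cell\<close>

definition tset :: "'a \<Rightarrow> ('p, 'a) form set \<Rightarrow> ('p, 'a) form \<Rightarrow> ('p, 'a) form set set" where
  "tset a w \<phi> = {v \<in> ccell a w. \<phi> \<in> v}"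

lemma tset_Neg [simp]: "tset a w (Neg \<phi>) = ccell a w - tset a w \<phi>"
  by (auto simp: tset_def ccell_mcs)

lemma tset_Con [simp]: "tset a w (Con \<phi> \<psi>) = tset a w \<phi> \<inter> tset a w \<psi>"
  by (auto simp: tset_def ccell_mcs)

lemma tset_ccell: "tset a w \<phi> \<subseteq> ccell a w"
  by (auto simp: tset_def)

lemma tset_cell_eq: "v \<in> ccell a w \<Longrightarrow> tset a v \<phi> = tset a w \<phi>"
  by (simp add: tset_def ccell_eq)

lemma mcs_Know_tset: "mcs w \<Longrightarrow> Know a \<phi> \<in> w \<longleftrightarrow> ccell a w \<subseteq> tset a w \<phi>"
  unfolding mcs_Know by (auto simp: tset_def)

text \<open>Belief depends on the two formulas only through truth sets in the cell: \<open>C\<close>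
  cuts the content down to the condition, \<open>M\<close> weakens it, and \<open>EC\<close>
  exchanges the condition.\<close>

lemma Bel_mono:
  assumes w: "mcs w" and B: "Bel a \<phi> \<psi> \<in> w"
    and eq: "tset a w \<phi> = tset a w \<phi>'" and le: "tset a w \<phi> \<inter> tset a w \<psi> \<subseteq> tset a w \<psi>'"
  shows "Bel a \<phi>' \<psi>' \<in> w"
proof -
  have "Bel a \<phi> (Con \<phi> \<psi>) \<in> w" using mcs_thm[OF w C[of a \<phi> \<psi>]] w B by simp
  moreover have "Know a (Imp (Con \<phi> \<psi>) \<psi>') \<in> w"
    using le by (simp add: mcs_Know_tset[OF w] del: mcs_Neg) blast
  ultimately have "Bel a \<phi> \<psi>' \<in> w"
    using mcs_thm[OF w M[of a "Con \<phi> \<psi>" \<psi>' \<phi>]] w by simp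
  moreover have "Know a (Iff \<phi> \<phi>') \<in> w"
    using eq by (auto simp: mcs_Know_tset[OF w] simp del: mcs_Neg)
  ultimately show ?thesis
    using mcs_thm[OF w EC[of a \<phi> \<phi>' \<psi>']] w by simp
qed

lemma Bel_D: "mcs w \<Longrightarrow> Bel a \<phi> \<psi> \<in> w \<Longrightarrow> Bel a \<phi> (Neg \<psi>) \<notin> w"
  using mcs_thm[of w, OF _ D[of a \<phi> \<psi>]] by simp

lemma Bel_SC:
  assumes w: "mcs w" and "Bel a \<chi> (Neg \<phi>) \<notin> w"
    and ne: "(tset a w \<chi> - tset a w \<phi>) \<inter> tset a w \<psi> \<noteq> {}"
  shows "Bel a \<chi> (Dis \<phi> \<psi>) \<in> w"
proof -
  let ?\<theta> = "Con (Con \<chi> (Neg \<phi>)) \<psi>"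
  have "\<not> ccell a w \<subseteq> tset a w (Neg ?\<theta>)"
    using ne tset_ccell[of a w] by auto
  then have "Know a (Neg ?\<theta>) \<notin> w" using mcs_Know_tset[OF w] by blast
  then have "Poss a ?\<theta> \<in> w" using w by simp
  then show ?thesis
    using mcs_thm[OF w SC[of a \<chi> \<phi> \<psi>]] w assms(2) by simp
qed


section \<open>Neighbourhoods at undefinable sets\<close>

text \<open>The sets in \<open>G\<close> are forced by upward closure, or by strict supersets of
  ties. No complementary pair is forced, since that would already violate \<open>d\<close> or
  \<open>sc\<close> inside \<open>D\<close>. Every pair in \<open>D\<close> is either settled by
  \<open>F0\<close> or a tie, so the arbitrary choice by a point never touches
  \<open>D\<close>.\<close>

lemma extend_family:
  assumes D: "D \<subseteq> Pow S" "\<And>U. U \<in> D \<Longrightarrow> S - U \<in> D"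
    and F0: "F0 \<subseteq> D"
    and d: "\<And>U. U \<in> F0 \<Longrightarrow> S - U \<notin> F0"
    and sc: "\<And>U V. U \<in> D \<Longrightarrow> V \<in> D \<Longrightarrow> S - U \<notin> F0 \<Longrightarrow> U \<subset> V \<Longrightarrow> V \<in> F0"
  shows "\<exists>F \<subseteq> Pow S. F \<inter> D = F0 \<and> (\<forall>U\<in>F. S - U \<notin> F) \<and>
    (\<forall>U V. U \<subseteq> S \<longrightarrow> V \<subseteq> S \<longrightarrow> S - U \<notin> F \<longrightarrow> U \<subset> V \<longrightarrow> V \<in> F)"
proof -
  \<comment> \<open>If \<open>S\<close> is empty, \<open>s\<close> is an unspecified value;
    \<open>s \<in> S\<close> is asserted only when \<open>S\<close> has a proper subset.\<close>
  define s where "s = (SOME s. s \<in> S)"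
  have s: "s \<in> S" if "U \<subset> V" "V \<subseteq> S" for U V
    using that unfolding s_def by (metis psubsetE someI subset_iff)
  \<comment> \<open>\<open>F\<close> may contain neither half of a tie, as it must meet
    \<open>D\<close> in \<open>F0\<close>; the target property then forces all strict supersets of
    both halves into \<open>F\<close>.\<close>
  define tie where "tie = {U \<in> D. U \<notin> F0 \<and> S - U \<notin> F0}"
  define G where "G = {U. U \<subseteq> S \<and> ((\<exists>Y\<in>F0. Y \<subseteq> U) \<or> (\<exists>T\<in>tie. T \<subset> U))}"
  define F where "F = G \<union> {U. U \<subseteq> S \<and> S - U \<notin> G \<and> U \<notin> tie \<and> s \<in> U}"
  have sub: "U \<subseteq> S" if "U \<in> D" for U using that D(1) by blast
  have dd: "S - (S - U) = U" if "U \<subseteq> S" for U using that by blast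
  have mono: "V \<in> F0" if "U \<in> F0" "V \<in> D" "U \<subseteq> V" for U V
    using that d sc[of U V] F0 by blast
  have tie_compl: "S - U \<in> tie" if "U \<in> tie" for U
    using that D(2)[of U] dd[OF sub[of U]] by (simp add: tie_def)
  have G_up: "V \<in> G" if "U \<in> G" "U \<subseteq> V" "V \<subseteq> S" for U V
  proof -
    have "(\<exists>Y\<in>F0. Y \<subseteq> U) \<or> (\<exists>T\<in>tie. T \<subset> U)" using that(1) by (simp add: G_def)
    then have "(\<exists>Y\<in>F0. Y \<subseteq> V) \<or> (\<exists>T\<in>tie. T \<subset> V)"
      using subset_trans[OF _ that(2)] psubset_subset_trans[OF _ that(2)] by metis
    then show ?thesis using that(3) by (simp add: G_def)
  qed
  have G_D: "U \<in> F0" if "U \<in> G" "U \<in> D" for U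
    using that(1) mono[OF _ that(2)] sc[OF _ that(2)] by (auto simp: G_def tie_def)
  have G_compl: "S - U \<notin> G" if "U \<in> G" for U
  proof
    assume "S - U \<in> G"
    \<comment> \<open>The inequalities record that a tie forces only its strict supersets.\<close>
    with that obtain Y Z where Y: "Y \<in> F0 \<or> Y \<in> tie \<and> Y \<noteq> U" "Y \<subseteq> U" "U \<subseteq> S"
      and Z: "Z \<in> F0 \<or> Z \<in> tie \<and> Z \<noteq> S - U" "Z \<subseteq> S - U"
      unfolding G_def by blast
    have YZ: "Y \<in> D" "Z \<in> D" using Y(1) Z(1) F0 by (auto simp: tie_def)
    show False
    proof (cases "Y = S - Z")
      case True
      \<comment> \<open>Both inclusions collapse, so neither witness can be a tie and a
        complementary pair lies in \<open>F0\<close>.\<close>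
      then have "Y = U" "Z = S - U" using Y Z sub[OF YZ(2)] by auto
      then show False using Y(1) Z(1) d by blast
    next
      case False
      \<comment> \<open>Whether \<open>Y\<close> is a member of \<open>F0\<close> or a tie,
        \<open>S - Z\<close> is now in \<open>F0\<close>; this excludes both options for
        \<open>Z\<close>.\<close>
      then have "Y \<subset> S - Z" using Y Z by blast
      then have "Y \<in> F0 \<Longrightarrow> S - Z \<in> F0" "S - Y \<notin> F0 \<Longrightarrow> S - Z \<in> F0"
        using mono[of Y "S - Z"] sc[of Y "S - Z"] YZ D(2) by blast+
      then have "S - Z \<in> F0" using Y(1) by (auto simp: tie_def)
      then show False using Z(1) d[of "S - Z"] dd sub[OF YZ(2)] by (auto simp: tie_def)
    qed
  qed
  have F_D: "F \<inter> D = F0"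
  proof
    show "F \<inter> D \<subseteq> F0"
    proof
      fix U assume "U \<in> F \<inter> D"
      then have U: "U \<in> F" "U \<in> D" by auto
      show "U \<in> F0"
      proof (cases "U \<in> G")
        case True
        then show ?thesis using G_D U by blast
      next
        case False
        then have "S - U \<notin> G" "U \<notin> tie" using U by (auto simp: F_def)
        moreover from this have "S - U \<notin> F0" by (auto simp: G_def)
        ultimately show ?thesis using U by (simp add: tie_def)
      qed
    qed
    show "F0 \<subseteq> F \<inter> D" using F0 sub by (auto simp: F_def G_def)
  qed
  have F_compl: "S - U \<notin> F" if U: "U \<in> F" for U
  proof (cases "U \<in> G")
    case True
    moreover from this have "U \<subseteq> S" by (simp add: G_def)
    ultimately show ?thesis using G_compl dd by (auto simp: F_def)
  next
    case False
    then show ?thesis using U by (auto simp: F_def)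
  qed
  have F_sc: "V \<in> F" if "U \<subseteq> S" "V \<subseteq> S" "S - U \<notin> F" "U \<subset> V" for U V
  proof (cases "V \<in> G \<or> U \<in> tie")
    case True
    then show ?thesis using that by (auto simp: F_def G_def)
  next
    case False
    have "U \<notin> G" using False G_up that by blast
    have "S - U \<notin> G" using that by (simp add: F_def)
    have "S - U \<notin> tie" using False tie_compl[of "S - U"] dd that by auto
    \<comment> \<open>\<open>S - U\<close> passes every test of the second part of \<open>F\<close>
      except possibly that of containing \<open>s\<close>, so its absence from \<open>F\<close> puts
      \<open>s\<close> into \<open>U\<close> and hence into \<open>V\<close>.\<close>
    then have "s \<in> U"
      using \<open>U \<notin> G\<close> that s[OF that(4,2)] dd by (auto simp: F_def)
    moreover have "S - V \<notin> G" using \<open>S - U \<notin> G\<close> G_up[of "S - V" "S - U"] that by blast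
    moreover have "V \<notin> tie"
    proof
      assume "V \<in> tie"
      then have "S - V \<in> tie" by (rule tie_compl)
      moreover have "S - V \<subset> S - U" using that by blast
      ultimately have "S - U \<in> G" by (auto simp: G_def)
      then show False using \<open>S - U \<notin> G\<close> by blast
    qed
    ultimately show ?thesis using that by (auto simp: F_def)
  qed
  have "F \<subseteq> Pow S" by (auto simp: F_def G_def)
  then show ?thesis using F_D F_compl F_sc by blast
qed

text \<open>Indexed by the set \<open>S\<close> and not by a formula, so that neighbourhoods depend
  only on sets, as condition (ec) requires. If \<open>S\<close> is no truth set, this family is
  empty.\<close>

definition definable :: "'a \<Rightarrow> ('p, 'a) form set \<Rightarrow> ('p, 'a) form set set \<Rightarrow> ('p, 'a) form set set set" where
  "definable a w S = {S \<inter> tset a w \<psi> | \<phi> \<psi>. S = tset a w \<phi>}"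

definition believed :: "'a \<Rightarrow> ('p, 'a) form set \<Rightarrow> ('p, 'a) form set set \<Rightarrow> ('p, 'a) form set set set" where
  "believed a w S = {S \<inter> tset a w \<psi> | \<phi> \<psi>. S = tset a w \<phi> \<and> Bel a \<phi> \<psi> \<in> w}"

lemma believed_iff:
  assumes w: "mcs w"
  shows "tset a w \<phi> \<inter> tset a w \<psi> \<in> believed a w (tset a w \<phi>) \<longleftrightarrow> Bel a \<phi> \<psi> \<in> w"
proof
  assume "tset a w \<phi> \<inter> tset a w \<psi> \<in> believed a w (tset a w \<phi>)"
  then obtain \<phi>' \<psi>' where "tset a w \<phi>' = tset a w \<phi>" "Bel a \<phi>' \<psi>' \<in> w"
    "tset a w \<phi> \<inter> tset a w \<psi> = tset a w \<phi> \<inter> tset a w \<psi>'"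
    by (auto simp: believed_def)
  then show "Bel a \<phi> \<psi> \<in> w" using Bel_mono[OF w, of a \<phi>' \<psi>' \<phi> \<psi>] by blast
qed (auto simp: believed_def)

definition family_ext ::
  "'a \<Rightarrow> ('p, 'a) form set \<Rightarrow> ('p, 'a) form set set \<Rightarrow> ('p, 'a) form set set set \<Rightarrow> bool" where
  "family_ext a w S F \<longleftrightarrow> F \<subseteq> Pow S \<and> F \<inter> definable a w S = believed a w S \<and>
    (\<forall>U\<in>F. S - U \<notin> F) \<and>
    (\<forall>U V. U \<subseteq> S \<longrightarrow> V \<subseteq> S \<longrightarrow> S - U \<notin> F \<longrightarrow> U \<subset> V \<longrightarrow> V \<in> F)"

text \<open>The axioms \<open>D\<close> and \<open>SC\<close> are the two hypotheses of
  \<open>extend_family\<close> on the definable subsets of \<open>S\<close>.\<close>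

lemma family_ext_exists:
  assumes w: "mcs w"
  shows "\<exists>F. family_ext a w S F"
proof -
  have compl: "S - (S \<inter> tset a w \<psi>) = S \<inter> tset a w (Neg \<psi>)" if "S = tset a w \<phi>" for \<phi> \<psi>
    using that tset_ccell[of a w \<phi>] by auto
  have "\<exists>F \<subseteq> Pow S. F \<inter> definable a w S = believed a w S \<and> (\<forall>U\<in>F. S - U \<notin> F) \<and>
    (\<forall>U V. U \<subseteq> S \<longrightarrow> V \<subseteq> S \<longrightarrow> S - U \<notin> F \<longrightarrow> U \<subset> V \<longrightarrow> V \<in> F)"
  proof (rule extend_family)
    show "definable a w S \<subseteq> Pow S" by (auto simp: definable_def)
    show "S - U \<in> definable a w S" if "U \<in> definable a w S" for U
      using that compl unfolding definable_def by blast
    show "believed a w S \<subseteq> definable a w S" by (auto simp: definable_def believed_def)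
    show "S - U \<notin> believed a w S" if U: "U \<in> believed a w S" for U
    proof -
      obtain \<phi> \<psi> where S: "S = tset a w \<phi>" and "U = S \<inter> tset a w \<psi>" "Bel a \<phi> \<psi> \<in> w"
        using U by (auto simp: believed_def)
      then show ?thesis using Bel_D[OF w] compl[OF S] believed_iff[OF w] by metis
    qed
    show "V \<in> believed a w S"
      if U: "U \<in> definable a w S" and V: "V \<in> definable a w S"
        and n: "S - U \<notin> believed a w S" and lt: "U \<subset> V" for U V
    proof -
      obtain \<phi> \<psi> where S: "S = tset a w \<phi>" and U: "U = S \<inter> tset a w \<psi>"
        using U by (auto simp: definable_def)
      obtain \<chi> where V: "V = S \<inter> tset a w \<chi>" using V by (auto simp: definable_def)
      have "Bel a \<phi> (Neg \<psi>) \<notin> w" using n believed_iff[OF w] compl[OF S] U S by metis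
      moreover have "(tset a w \<phi> - tset a w \<psi>) \<inter> tset a w \<chi> \<noteq> {}" using lt U V S by blast
      ultimately have "Bel a \<phi> (Dis \<psi> \<chi>) \<in> w" by (rule Bel_SC[OF w])
      \<comment> \<open>As \<open>U\<close> lies inside \<open>V\<close>, the disjunction and
        \<open>\<chi>\<close> cut the same subset \<open>V\<close> out of \<open>S\<close>.\<close>
      then have "Bel a \<phi> \<chi> \<in> w"
        by (rule Bel_mono[OF w]) (use lt U V S in auto)
      then show ?thesis using believed_iff[OF w] V S by metis
    qed
  qed
  then show ?thesis unfolding family_ext_def by blast
qed


section \<open>The canonical model\<close>

definition family :: "'a \<Rightarrow> ('p, 'a) form set \<Rightarrow> ('p, 'a) form set set \<Rightarrow> ('p, 'a) form set set set" where
  "family a w S = (SOME F. family_ext a w S F)"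

lemma family_ext_family: "mcs w \<Longrightarrow> family_ext a w S (family a w S)"
  unfolding family_def by (rule someI_ex[OF family_ext_exists])

lemma family_subset: "mcs w \<Longrightarrow> U \<in> family a w S \<Longrightarrow> U \<subseteq> S"
  using family_ext_family[of w a S] by (auto simp: family_ext_def)

lemma family_compl: "mcs w \<Longrightarrow> U \<in> family a w S \<Longrightarrow> S - U \<notin> family a w S"
  using family_ext_family[of w a S] by (auto simp: family_ext_def)

lemma family_sc:
  "mcs w \<Longrightarrow> U \<subseteq> S \<Longrightarrow> V \<subseteq> S \<Longrightarrow> S - U \<notin> family a w S \<Longrightarrow> U \<subset> V \<Longrightarrow> V \<in> family a w S"
  using family_ext_family[of w a S] unfolding family_ext_def by meson

lemma family_up: "mcs w \<Longrightarrow> U \<in> family a w S \<Longrightarrow> U \<subseteq> V \<Longrightarrow> V \<subseteq> S \<Longrightarrow> V \<in> family a w S"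
  using family_sc[of w U S V a] family_compl[of w U a S] by blast

text \<open>Either \<open>S\<close>, the complement of the empty set in \<open>S\<close>, is already
  a member, or the strict-superset condition applied to the empty set makes it one.\<close>

lemma family_self:
  assumes "mcs w" "S \<noteq> {}"
  shows "S \<in> family a w S"
  using family_sc[of w "{}" S S a] assms by auto

lemma family_Bel:
  assumes w: "mcs w"
  shows "tset a w \<phi> \<inter> tset a w \<psi> \<in> family a w (tset a w \<phi>) \<longleftrightarrow> Bel a \<phi> \<psi> \<in> w"
proof -
  have "tset a w \<phi> \<inter> tset a w \<psi> \<in> definable a w (tset a w \<phi>)"
    by (auto simp: definable_def)
  then show ?thesis
    using family_ext_family[OF w, of a "tset a w \<phi>"] believed_iff[OF w, of a \<phi> \<psi>]
    by (auto simp: family_ext_def)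
qed

text \<open>The predicate under \<open>SOME\<close> mentions \<open>w\<close> only through truth
  sets in its cell and belief formulas of \<open>a\<close>, so all worlds of a cell make the same
  choice.\<close>

lemma family_cong: "v \<in> ccell a w \<Longrightarrow> family a v S = family a w S"
  by (simp add: family_def family_ext_def[abs_def] definable_def believed_def tset_cell_eq ccell_Bel)

definition canon :: "(('p, 'a) form set, 'p, 'a) cn_struct" where
  "canon = \<lparr>worlds = Collect mcs,
    nbh = \<lambda>a w X. family a w (X \<inter> ccell a w),
    val = \<lambda>p. {w. mcs w \<and> Atom p \<in> w}\<rparr>"

text \<open>Worlds with equal neighbourhood functions share a cell: at the set of all worlds,
  \<open>ccell a v\<close> is itself a neighbourhood of \<open>v\<close>, while every neighbourhood
  of \<open>w\<close> lies inside \<open>ccell a w\<close>.\<close>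

lemma cell_canon:
  assumes w: "mcs w"
  shows "cell canon a w = ccell a w"
proof (intro equalityI subsetI)
  fix v assume "v \<in> ccell a w"
  then show "v \<in> cell canon a w"
    by (simp add: cell_def canon_def ccell_mcs ccell_eq family_cong)
next
  fix v assume "v \<in> cell canon a w"
  then have v: "mcs v"
    and "family a w (Collect mcs \<inter> ccell a w) = family a v (Collect mcs \<inter> ccell a v)"
    by (auto simp: cell_def canon_def)
  moreover have "Collect mcs \<inter> ccell a w = ccell a w" "Collect mcs \<inter> ccell a v = ccell a v"
    by (auto simp: ccell_def)
  ultimately have "family a w (ccell a w) = family a v (ccell a v)" by simp
  moreover have "ccell a w \<in> family a w (ccell a w)" "ccell a v \<in> family a v (ccell a v)"
    using family_self[OF w, of "ccell a w" a] family_self[OF v, of "ccell a v" a]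
      ccell_refl[OF w, of a] ccell_refl[OF v, of a] by fastforce+
  ultimately have "ccell a v \<subseteq> ccell a w"
    using family_subset[OF w, of "ccell a v" a "ccell a w"] by simp
  then show "v \<in> ccell a w" using ccell_refl[OF v, of a] by blast
qed

lemma cn_model_canon:
  assumes "mcs (w0 :: ('p, 'a) form set)"
  shows "cn_model (canon :: (('p, 'a) form set, 'p, 'a) cn_struct)"
proof -
  let ?M = "canon :: (('p, 'a) form set, 'p, 'a) cn_struct"
  have nbh: "nbh ?M a w X = family a w (X \<inter> ccell a w)" for a w and X :: "('p, 'a) form set set"
    by (simp add: canon_def)
  have worlds: "worlds ?M = Collect mcs" by (simp add: canon_def)
  show ?thesis
    unfolding cn_model_def
  proof (intro conjI allI ballI impI)
    show "worlds ?M \<noteq> {}" using assms by (auto simp: worlds)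
    show "val ?M p \<subseteq> worlds ?M" for p by (auto simp: canon_def)
  next
    fix a :: 'a and w :: "('p, 'a) form set" and X
    assume "w \<in> worlds ?M"
    then have w: "mcs w" by (simp add: worlds)
    note [simp] = cell_canon[OF w] nbh
    show "Y \<subseteq> X \<inter> cell ?M a w" if "Y \<in> nbh ?M a w X" for Y
      using that family_subset[OF w, of Y a "X \<inter> ccell a w"] by simp
    show "nbh ?M a w X = nbh ?M a w Y" if "X \<inter> cell ?M a w = Y \<inter> cell ?M a w" for Y
      using that by simp
    show "X \<inter> cell ?M a w - Y \<notin> nbh ?M a w X" if "Y \<in> nbh ?M a w X" for Y
      using that family_compl[OF w, of Y a "X \<inter> ccell a w"] by simp
    show "Z \<in> nbh ?M a w X"
      if "Y \<subseteq> X \<inter> cell ?M a w" "Z \<subseteq> X \<inter> cell ?M a w"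
        "X \<inter> cell ?M a w - Y \<notin> nbh ?M a w X" "Y \<subset> Z" for Y Z
      using that family_sc[OF w, of Y "X \<inter> ccell a w" Z a] by simp
  qed
qed

section \<open>Truth lemma and completeness for update-free formulas\<close>

fun upd_free :: "('p, 'a) form \<Rightarrow> bool" where
  "upd_free Top \<longleftrightarrow> True"
| "upd_free (Atom p) \<longleftrightarrow> True"
| "upd_free (Neg \<phi>) \<longleftrightarrow> upd_free \<phi>"
| "upd_free (Con \<phi> \<psi>) \<longleftrightarrow> upd_free \<phi> \<and> upd_free \<psi>"
| "upd_free (Bel a \<phi> \<psi>) \<longleftrightarrow> upd_free \<phi> \<and> upd_free \<psi>"
| "upd_free (Upd \<phi> \<psi>) \<longleftrightarrow> False"

lemma truth_lemma: "upd_free \<phi> \<Longrightarrow> mcs w \<Longrightarrow> sat canon w \<phi> \<longleftrightarrow> \<phi> \<in> w"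
proof (induction \<phi> arbitrary: w)
  case (Atom p)
  then show ?case by (simp add: canon_def)
next
  case (Bel a \<phi> \<psi>)
  note w = Bel.prems(2)
  have sets: "{v \<in> worlds canon. sat canon v \<phi>} \<inter> ccell a w = tset a w \<phi>"
    "{v \<in> worlds canon. sat canon v \<psi>} \<inter> ccell a w = tset a w \<psi>"
    using Bel by (auto simp: tset_def canon_def ccell_mcs)
  have "sat canon w (Bel a \<phi> \<psi>) \<longleftrightarrow>
    (\<exists>Y \<in> family a w (tset a w \<phi>). Y \<subseteq> {v \<in> worlds canon. sat canon v \<psi>})"
    unfolding sets(1)[symmetric] by (simp add: canon_def)
  \<comment> \<open>Neighbourhoods are closed upwards within the condition, so the largest candidate
    decides the existential.\<close>
  also have "\<dots> \<longleftrightarrow> tset a w \<phi> \<inter> tset a w \<psi> \<in> family a w (tset a w \<phi>)"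
  proof
    assume "\<exists>Y \<in> family a w (tset a w \<phi>). Y \<subseteq> {v \<in> worlds canon. sat canon v \<psi>}"
    then obtain Y where Y: "Y \<in> family a w (tset a w \<phi>)" "Y \<subseteq> {v \<in> worlds canon. sat canon v \<psi>}"
      by blast
    then have "Y \<subseteq> tset a w \<phi> \<inter> tset a w \<psi>"
      using family_subset[OF w Y(1)] sets tset_ccell[of a w \<phi>] by blast
    then show "tset a w \<phi> \<inter> tset a w \<psi> \<in> family a w (tset a w \<phi>)"
      using family_up[OF w Y(1)] by blast
  next
    assume "tset a w \<phi> \<inter> tset a w \<psi> \<in> family a w (tset a w \<phi>)"
    moreover have "tset a w \<phi> \<inter> tset a w \<psi> \<subseteq> {v \<in> worlds canon. sat canon v \<psi>}"
      using sets(2) by blast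
    ultimately show "\<exists>Y \<in> family a w (tset a w \<phi>). Y \<subseteq> {v \<in> worlds canon. sat canon v \<psi>}"
      by (rule bexI[rotated])
  qed
  finally show ?case by (simp only: family_Bel[OF w])
qed auto

lemma completeness_upd_free:
  fixes \<phi> :: "('p, 'a) form"
  assumes "upd_free \<phi>" "valid \<phi>"
  shows "\<turnstile> \<phi>"
  unfolding derivable_iff_mcs
proof (intro allI impI)
  fix w :: "('p, 'a) form set" assume w: "mcs w"
  then have "sat canon w \<phi>"
    using assms(2) cn_model_canon[OF w] by (auto simp: valid_def canon_def)
  then show "\<phi> \<in> w" using truth_lemma assms(1) w by blast
qed


section \<open>Eliminating updates\<close>

fun red :: "('p, 'a) form \<Rightarrow> ('p, 'a) form \<Rightarrow> ('p, 'a) form" where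
  "red \<phi> Top = Top"
| "red \<phi> (Atom p) = Atom p"
| "red \<phi> (Neg \<psi>) = Neg (red \<phi> \<psi>)"
| "red \<phi> (Con \<psi> \<chi>) = Con (red \<phi> \<psi>) (red \<phi> \<chi>)"
| "red \<phi> (Bel a \<psi> \<chi>) = Con (Imp \<phi> (Bel a (Con \<phi> (red \<phi> \<psi>)) (red \<phi> \<chi>)))
     (Imp (Neg \<phi>) (Bel a (Con (Neg \<phi>) (red \<phi> \<psi>)) (red \<phi> \<chi>)))"
| "red \<phi> (Upd \<psi> \<chi>) = Upd \<phi> (Upd \<psi> \<chi>)"

text \<open>Updates are removed from the inside out, so \<open>red\<close> always receives an
  update-free formula and nested updates need no composition law.\<close>

fun elim_upd :: "('p, 'a) form \<Rightarrow> ('p, 'a) form" where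
  "elim_upd Top = Top"
| "elim_upd (Atom p) = Atom p"
| "elim_upd (Neg \<phi>) = Neg (elim_upd \<phi>)"
| "elim_upd (Con \<phi> \<psi>) = Con (elim_upd \<phi>) (elim_upd \<psi>)"
| "elim_upd (Bel a \<phi> \<psi>) = Bel a (elim_upd \<phi>) (elim_upd \<psi>)"
| "elim_upd (Upd \<phi> \<psi>) = red (elim_upd \<phi>) (elim_upd \<psi>)"

lemma upd_free_red: "upd_free \<phi> \<Longrightarrow> upd_free \<psi> \<Longrightarrow> upd_free (red \<phi> \<psi>)"
  by (induction \<psi>) auto

lemma upd_free_elim_upd: "upd_free (elim_upd \<phi>)"
  by (induction \<phi>) (auto simp: upd_free_red)

lemma Bel_cong:
  assumes "\<turnstile> Iff \<phi> \<phi>'" "\<turnstile> Iff \<psi> \<psi>'"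
  shows "\<turnstile> Iff (Bel a \<phi> \<psi>) (Bel a \<phi>' \<psi>')"
proof -
  have "tset a w \<phi> = tset a w \<phi>'" "tset a w \<psi> = tset a w \<psi>'" for w
    using assms by (auto simp: tset_def ccell_mcs derivable_Iff)
  then show ?thesis
    unfolding derivable_Iff by (metis Bel_mono inf_le2)
qed

text \<open>No reduction axiom covers \<open>\<top>\<close>, so it is first replaced by \<open>\<not>(\<top> \<and> \<not>\<top>)\<close>.\<close>

lemma derivable_Upd_Top:
  fixes \<phi> :: "('p, 'a) form"
  shows "\<turnstile> Upd \<phi> Top"
  unfolding derivable_iff_mcs
proof (intro allI impI)
  fix w :: "('p, 'a) form set" assume w: "mcs w"
  have "\<turnstile> Iff Top (Neg (Con Top (Neg Top)))" by (simp add: Taut tautology_def)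
  then have "\<turnstile> Iff (Upd \<phi> Top) (Upd \<phi> (Neg (Con Top (Neg Top))))" by (rule RE_Upd)
  moreover have "Upd \<phi> (Neg (Con Top (Neg Top))) \<in> w"
    using w mcs_derivable_Iff[OF w Upd_Neg[of \<phi> Top]]
      mcs_derivable_Iff[OF w Upd_Neg[of \<phi> "Con Top (Neg Top)"]]
      mcs_derivable_Iff[OF w Upd_Con[of \<phi> Top "Neg Top"]]
    by simp
  ultimately show "Upd \<phi> Top \<in> w" using mcs_derivable_Iff[OF w] by blast
qed

text \<open>\<open>RE_Upd\<close> replaces equivalents below an update but not the updating formula.
  The exchange of \<open>\<phi>\<close> for \<open>\<phi>'\<close> is therefore built into this
  induction, where it happens in the belief case.\<close>

lemma derivable_red:
  assumes \<phi>: "\<turnstile> Iff \<phi> \<phi>'" and "upd_free \<psi>"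
  shows "\<turnstile> Iff (Upd \<phi> \<psi>) (red \<phi>' \<psi>)"
  using assms(2)
proof (induction \<psi>)
  case Top
  then show ?case using derivable_Upd_Top[of \<phi>] by (simp add: derivable_iff_mcs)
next
  case (Atom p)
  then show ?case using Upd_Atom by simp
next
  case (Neg \<psi>)
  then show ?case using Upd_Neg[of \<phi> \<psi>] by (simp add: derivable_Iff)
next
  case (Con \<psi> \<chi>)
  then show ?case using Upd_Con[of \<phi> \<psi> \<chi>] by (simp add: derivable_Iff)
next
  case (Bel a \<psi> \<chi>)
  then have \<psi>: "\<turnstile> Iff (Upd \<phi> \<psi>) (red \<phi>' \<psi>)" and \<chi>: "\<turnstile> Iff (Upd \<phi> \<chi>) (red \<phi>' \<chi>)" by simp_all
  have "\<turnstile> Iff (Con \<phi> (Upd \<phi> \<psi>)) (Con \<phi>' (red \<phi>' \<psi>))"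
    "\<turnstile> Iff (Con (Neg \<phi>) (Upd \<phi> \<psi>)) (Con (Neg \<phi>') (red \<phi>' \<psi>))"
    using \<phi> \<psi> by (simp_all add: derivable_Iff)
  note this[THEN Bel_cong[OF _ \<chi>], of a]
  then show ?case
    using Upd_Bel[of \<phi> a \<psi> \<chi>] \<phi> by (simp add: derivable_Iff)
qed simp

lemma derivable_elim_upd: "\<turnstile> Iff \<phi> (elim_upd \<phi>)"
proof (induction \<phi>)
  case (Bel a \<phi> \<psi>)
  then show ?case by (simp add: Bel_cong)
next
  case (Upd \<phi> \<psi>)
  have "\<turnstile> Iff (Upd \<phi> (elim_upd \<psi>)) (red (elim_upd \<phi>) (elim_upd \<psi>))"
    using Upd.IH(1) upd_free_elim_upd by (rule derivable_red)
  then show ?case using RE_Upd[OF Upd.IH(2), of \<phi>] by (simp add: derivable_Iff)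
qed (simp_all add: derivable_Iff)

section \<open>Updated models and soundness of the reduction\<close>

lemma worlds_update [simp]: "worlds (update M A) = worlds M"
  by (simp add: update_def)

lemma nbh_update [simp]: "nbh (update M A) a w X = nbh M a w (X \<inter> upd_cell M A a w)"
  by (simp add: update_def)

lemma val_update [simp]: "val (update M A) = val M"
  by (simp add: update_def)

lemma cn_model_nbh:
  assumes "cn_model M" "w \<in> worlds M" "X \<subseteq> worlds M"
  shows cn_model_c: "Y \<in> nbh M a w X \<Longrightarrow> Y \<subseteq> X \<inter> cell M a w"
    and cn_model_ec: "Z \<subseteq> worlds M \<Longrightarrow> X \<inter> cell M a w = Z \<inter> cell M a w \<Longrightarrow> nbh M a w X = nbh M a w Z"
    and cn_model_d: "Y \<in> nbh M a w X \<Longrightarrow> (X \<inter> cell M a w) - Y \<notin> nbh M a w X"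
    and cn_model_sc: "Y \<subseteq> X \<inter> cell M a w \<Longrightarrow> Z \<subseteq> X \<inter> cell M a w \<Longrightarrow>
      (X \<inter> cell M a w) - Y \<notin> nbh M a w X \<Longrightarrow> Y \<subset> Z \<Longrightarrow> Z \<in> nbh M a w X"
proof -
  have *: "(\<forall>Y \<in> nbh M a w X. Y \<subseteq> X \<inter> cell M a w) \<and>
    (\<forall>Y \<subseteq> worlds M. X \<inter> cell M a w = Y \<inter> cell M a w \<longrightarrow> nbh M a w X = nbh M a w Y) \<and>
    (\<forall>Y \<in> nbh M a w X. (X \<inter> cell M a w) - Y \<notin> nbh M a w X) \<and>
    (\<forall>Y Z. Y \<subseteq> X \<inter> cell M a w \<longrightarrow> Z \<subseteq> X \<inter> cell M a w \<longrightarrow>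
       (X \<inter> cell M a w) - Y \<notin> nbh M a w X \<longrightarrow> Y \<subset> Z \<longrightarrow> Z \<in> nbh M a w X)"
    using assms(1)[unfolded cn_model_def, THEN conjunct2, THEN conjunct2,
      THEN spec, THEN bspec, OF assms(2), THEN spec, THEN mp, OF assms(3)] .
  show "Y \<in> nbh M a w X \<Longrightarrow> Y \<subseteq> X \<inter> cell M a w"
    using *[THEN conjunct1] by (rule bspec)
  show "Z \<subseteq> worlds M \<Longrightarrow> X \<inter> cell M a w = Z \<inter> cell M a w \<Longrightarrow> nbh M a w X = nbh M a w Z"
    using *[THEN conjunct2, THEN conjunct1] by (elim allE impE)
  show "Y \<in> nbh M a w X \<Longrightarrow> (X \<inter> cell M a w) - Y \<notin> nbh M a w X"
    using *[THEN conjunct2, THEN conjunct2, THEN conjunct1] by (rule bspec)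
  show "Y \<subseteq> X \<inter> cell M a w \<Longrightarrow> Z \<subseteq> X \<inter> cell M a w \<Longrightarrow>
      (X \<inter> cell M a w) - Y \<notin> nbh M a w X \<Longrightarrow> Y \<subset> Z \<Longrightarrow> Z \<in> nbh M a w X"
    using *[THEN conjunct2, THEN conjunct2, THEN conjunct2] by (elim allE impE)
qed

lemma cn_model_self:
  assumes "cn_model M" "w \<in> worlds M" "X \<subseteq> worlds M" "X \<inter> cell M a w \<noteq> {}"
  shows "X \<inter> cell M a w \<in> nbh M a w X"
  using cn_model_sc[OF assms(1-3), of "{}" a "X \<inter> cell M a w"] assms(4) by auto

lemma cell_refl: "w \<in> worlds M \<Longrightarrow> w \<in> cell M a w"
  by (simp add: cell_def)

lemma cell_worlds: "cell M a w \<subseteq> worlds M"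
  by (auto simp: cell_def)

lemma upd_cell_subset: "upd_cell M A a w \<subseteq> cell M a w"
  by (auto simp: upd_cell_def)

lemma upd_cell_refl: "w \<in> worlds M \<Longrightarrow> w \<in> upd_cell M A a w"
  by (simp add: upd_cell_def cell_refl)

text \<open>The cell induced by the new neighbourhood function is the intended refined class. As for
  the canonical model, \<open>upd_cell M A a v\<close> is a neighbourhood of \<open>v\<close> at the
  set of all worlds, and those of \<open>w\<close> lie inside
  \<open>upd_cell M A a w\<close>.\<close>

lemma cell_update:
  assumes M: "cn_model M" and w: "w \<in> worlds M"
  shows "cell (update M A) a w = upd_cell M A a w"
proof (intro equalityI subsetI)
  fix v assume "v \<in> upd_cell M A a w"
  then have v: "v \<in> cell M a w" "w \<in> A \<longleftrightarrow> v \<in> A" by (auto simp: upd_cell_def)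
  then have "cell M a v = cell M a w" by (auto simp: cell_def)
  then have "upd_cell M A a v = upd_cell M A a w" using v by (auto simp: upd_cell_def)
  then show "v \<in> cell (update M A) a w" using v(1) by (simp add: cell_def le_infI1)
next
  fix v assume "v \<in> cell (update M A) a w"
  then have v: "v \<in> worlds M"
    and eq: "\<And>X. X \<subseteq> worlds M \<Longrightarrow>
      nbh M a w (X \<inter> upd_cell M A a w) = nbh M a v (X \<inter> upd_cell M A a v)"
    by (auto simp: cell_def)
  have W: "upd_cell M A a u \<subseteq> worlds M" for u
    using upd_cell_subset cell_worlds by (rule subset_trans)
  have cap: "upd_cell M A a u \<inter> cell M a u = upd_cell M A a u"
    "worlds M \<inter> upd_cell M A a u = upd_cell M A a u" for u
    using upd_cell_subset[of M A a u] W[of u] by auto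
  have "upd_cell M A a v \<in> nbh M a v (upd_cell M A a v)"
    using cn_model_self[OF M v W, of v a] upd_cell_refl[OF v, of A a] by (auto simp: cap)
  also have "\<dots> = nbh M a w (upd_cell M A a w)"
    using eq[of "worlds M"] by (simp add: cap)
  finally have "upd_cell M A a v \<subseteq> upd_cell M A a w"
    using cn_model_c[OF M w W[of w]] by simp
  then show "v \<in> upd_cell M A a w" using upd_cell_refl[OF v, of A a] by blast
qed

text \<open>Each condition at \<open>X\<close> is the same condition of \<open>M\<close> at
  \<open>X \<inter> upd_cell M A a w\<close>, because the refined class lies inside the old
  cell.\<close>

lemma cn_model_update:
  assumes M: "cn_model M"
  shows "cn_model (update M A)"
  unfolding cn_model_def
proof (intro conjI allI ballI impI)
  show "worlds (update M A) \<noteq> {}" "\<And>p. val (update M A) p \<subseteq> worlds (update M A)"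
    using M by (auto simp: cn_model_def)
next
  fix a w X
  assume "w \<in> worlds (update M A)" "X \<subseteq> worlds (update M A)"
  then have w: "w \<in> worlds M" and X: "X \<inter> upd_cell M A a w \<subseteq> worlds M" by auto
  note [simp] = cell_update[OF M w]
  have cap: "(X \<inter> upd_cell M A a w) \<inter> cell M a w = X \<inter> upd_cell M A a w"
    using upd_cell_subset[of M A a w] by blast
  show "Y \<subseteq> X \<inter> cell (update M A) a w" if "Y \<in> nbh (update M A) a w X" for Y
    using that cn_model_c[OF M w X, of Y a] by (simp add: cap)
  show "nbh (update M A) a w X = nbh (update M A) a w Y"
    if "X \<inter> cell (update M A) a w = Y \<inter> cell (update M A) a w" for Y
    using that by simp
  show "X \<inter> cell (update M A) a w - Y \<notin> nbh (update M A) a w X"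
    if "Y \<in> nbh (update M A) a w X" for Y
    using that cn_model_d[OF M w X, of Y a] by (simp add: cap)
  show "Z \<in> nbh (update M A) a w X"
    if "Y \<subseteq> X \<inter> cell (update M A) a w" "Z \<subseteq> X \<inter> cell (update M A) a w"
      "X \<inter> cell (update M A) a w - Y \<notin> nbh (update M A) a w X" "Y \<subset> Z" for Y Z
    using that cn_model_sc[OF M w X, of Y a Z] by (simp add: cap)
qed

lemma sat_red:
  assumes M: "cn_model M"
  shows "upd_free \<psi> \<Longrightarrow> w \<in> worlds M \<Longrightarrow>
    sat M w (red \<phi> \<psi>) \<longleftrightarrow> sat (update M {v \<in> worlds M. sat M v \<phi>}) w \<psi>"
proof (induction \<psi> arbitrary: w)
  case (Bel a \<psi> \<chi>)
  let ?A = "{v \<in> worlds M. sat M v \<phi>}"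
  let ?X = "{v \<in> worlds M. sat (update M ?A) v \<psi>}"
  \<comment> \<open>The refined class of \<open>w\<close> is the part of its cell where
    \<open>\<theta>\<close> holds, so (ec) identifies the two neighbourhood families; the other
    conjunct of the reduction axiom holds vacuously at \<open>w\<close>.\<close>
  define \<theta> where "\<theta> = (if sat M w \<phi> then \<phi> else Neg \<phi>)"
  note w = Bel.prems(2)
  have \<psi>: "{v \<in> worlds M. sat M v (red \<phi> \<psi>)} = ?X"
    and \<chi>: "{v \<in> worlds M. sat M v (red \<phi> \<chi>)} = {v \<in> worlds M. sat (update M ?A) v \<chi>}"
    using Bel by auto
  have "{v \<in> worlds M. sat M v (Con \<theta> (red \<phi> \<psi>))} \<inter> cell M a w
      = (?X \<inter> upd_cell M ?A a w) \<inter> cell M a w"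
    using \<psi> w cell_worlds[of M a w] by (auto simp: \<theta>_def upd_cell_def)
  then have "nbh M a w {v \<in> worlds M. sat M v (Con \<theta> (red \<phi> \<psi>))}
      = nbh M a w (?X \<inter> upd_cell M ?A a w)"
    by (intro cn_model_ec[OF M w]) auto
  then have "sat M w (Bel a (Con \<theta> (red \<phi> \<psi>)) (red \<phi> \<chi>)) \<longleftrightarrow> sat (update M ?A) w (Bel a \<psi> \<chi>)"
    using \<chi> by simp
  moreover have "sat M w (red \<phi> (Bel a \<psi> \<chi>)) \<longleftrightarrow> sat M w (Bel a (Con \<theta> (red \<phi> \<psi>)) (red \<phi> \<chi>))"
    by (simp add: \<theta>_def)
  ultimately show ?case by blast
qed auto

text \<open>The induction ranges over all models, since the update case calls it at the updated
  model, again a model by \<open>cn_model_update\<close>.\<close>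

lemma sat_elim_upd: "cn_model M \<Longrightarrow> w \<in> worlds M \<Longrightarrow> sat M w (elim_upd \<phi>) \<longleftrightarrow> sat M w \<phi>"
proof (induction \<phi> arbitrary: M w)
  case (Bel a \<phi> \<psi>)
  then have "{v \<in> worlds M. sat M v (elim_upd \<phi>)} = {v \<in> worlds M. sat M v \<phi>}"
    "{v \<in> worlds M. sat M v (elim_upd \<psi>)} = {v \<in> worlds M. sat M v \<psi>}" by auto
  then show ?case by simp
next
  case (Upd \<phi> \<psi>)
  then have "{v \<in> worlds M. sat M v (elim_upd \<phi>)} = {v \<in> worlds M. sat M v \<phi>}" by auto
  then show ?case
    using Upd by (simp add: sat_red upd_free_elim_upd cn_model_update)
qed auto

theorem theorem9:
  fixes \<phi> :: "('p, 'a :: finite) form"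
  assumes "valid \<phi>"
  shows "\<turnstile> \<phi>"
proof -
  have "valid (elim_upd \<phi>)" using assms by (simp add: valid_def sat_elim_upd)
  then have "\<turnstile> elim_upd \<phi>" using upd_free_elim_upd by (intro completeness_upd_free)
  then show ?thesis using derivable_elim_upd[of \<phi>] by (simp add: derivable_iff_mcs)
qed

end
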